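(* Let $(M,g)$ be a surface of constant curvature with the metric tensor $$g=\frac{dx^2+dy^2}{(1+\kappa(x^2+y^2))^2},$$ where $\kappa$ is a constant. Then the level sets of a function $f(x,y)$ are geodesics of the metric $g$ if and only if $f$ satisfies the equation $$f_y^2f_{xx}-2f_xf_yf_{xy}+f_x^2f_{yy}=\frac{2\kappa\,(xf_x+yf_y)(f_x^2+f_y^2)}{1+\kappa(x^2+y^2)} .$$
   Context: Here $(x,y)$ range over a domain of $\mathbb{R}^2$ on which $1+\kappa(x^2+y^2)\ne0$, and $f$ is a smooth function defining a foliation by its level sets, i.e. $df\neq0$ at every point. Level sets are geodesics in the sense of unparametrized curves. *)

theory Defs
  imports "HOL-Analysis.Analysis"
begin

text \<open>
  Coordinates on the plane: \<open>x = p $ 1\<close> and \<open>y = p $ 2\<close>, for \<open>p :: real ^ 2\<close>.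
\<close>

definition pderiv_at :: "2 \<Rightarrow> (real ^ 2 \<Rightarrow> real) \<Rightarrow> real ^ 2 \<Rightarrow> real" where
  "pderiv_at i f p = frechet_derivative f (at p) (axis i 1)"

text \<open>
  \<open>C^k\<close> and smooth functions. The derivatives are full derivatives at the points of \<open>S\<close>,
  so these notions are meant for open \<open>S\<close> only.
\<close>

primrec Ck_on :: "nat \<Rightarrow> (real ^ 2 \<Rightarrow> real) \<Rightarrow> (real ^ 2) set \<Rightarrow> bool" where
  "Ck_on 0 f S \<longleftrightarrow> continuous_on S f"
| "Ck_on (Suc k) f S \<longleftrightarrow> (\<forall>p\<in>S. f differentiable (at p)) \<and> (\<forall>i. Ck_on k (pderiv_at i f) S)"

definition smooth_on :: "(real ^ 2 \<Rightarrow> real) \<Rightarrow> (real ^ 2) set \<Rightarrow> bool" where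
  "smooth_on f S \<longleftrightarrow> (\<forall>k. Ck_on k f S)"

text \<open>
  A metric tensor in coordinates is its Gram matrix field: \<open>g p $ i $ j\<close> is \<open>g\<^sub>i\<^sub>j(p)\<close>.
\<close>

type_synonym metric_tensor = "real ^ 2 \<Rightarrow> real ^ 2 ^ 2"

text \<open>\<open>christoffel g k i j\<close> is the Levi-Civita symbol with upper index \<open>k\<close>, lower indices \<open>i j\<close>.\<close>

definition christoffel :: "metric_tensor \<Rightarrow> 2 \<Rightarrow> 2 \<Rightarrow> 2 \<Rightarrow> real ^ 2 \<Rightarrow> real" where
  "christoffel g k i j p =
     (\<Sum>l\<in>UNIV. matrix_inv (g p) $ k $ l *
        (pderiv_at i (\<lambda>q. g q $ j $ l) p + pderiv_at j (\<lambda>q. g q $ i $ l) p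
          - pderiv_at l (\<lambda>q. g q $ i $ j) p)) / 2"

definition velocity :: "(real \<Rightarrow> real ^ 2) \<Rightarrow> real \<Rightarrow> real ^ 2" where
  "velocity \<gamma> t = vector_derivative \<gamma> (at t)"

text \<open>The covariant derivative of the velocity field along \<open>\<gamma>\<close>.\<close>

definition cov_acceleration :: "metric_tensor \<Rightarrow> (real \<Rightarrow> real ^ 2) \<Rightarrow> real \<Rightarrow> real ^ 2" where
  "cov_acceleration g \<gamma> t =
     (\<chi> k. vector_derivative (velocity \<gamma>) (at t) $ k
        + (\<Sum>i\<in>UNIV. \<Sum>j\<in>UNIV. christoffel g k i j (\<gamma> t) * velocity \<gamma> t $ i * velocity \<gamma> t $ j))"

text \<open>
  Affinely parametrized, nonconstant geodesics, on an open interval \<open>I\<close>.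
\<close>

definition geodesic_on :: "metric_tensor \<Rightarrow> real set \<Rightarrow> (real \<Rightarrow> real ^ 2) \<Rightarrow> bool" where
  "geodesic_on g I \<gamma> \<longleftrightarrow>
     (\<forall>t\<in>I. \<gamma> differentiable (at t) \<and> velocity \<gamma> differentiable (at t)
        \<and> velocity \<gamma> t \<noteq> 0 \<and> cov_acceleration g \<gamma> t = 0)"

text \<open>
  A set is an unparametrized geodesic if near each of its points it is the trace of a
  parametrized one. The local form is needed because a level set may have several
  (even infinitely many) connected components, each being a geodesic.
\<close>

definition unparametrized_geodesic :: "metric_tensor \<Rightarrow> (real ^ 2) set \<Rightarrow> bool" where
  "unparametrized_geodesic g C \<longleftrightarrow>
     (\<forall>p\<in>C. \<exists>U I \<gamma>. open U \<and> p \<in> U \<and> open I \<and> is_interval I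
        \<and> geodesic_on g I \<gamma> \<and> \<gamma> ` I = C \<inter> U)"

definition level_sets_geodesic ::
    "metric_tensor \<Rightarrow> (real ^ 2) set \<Rightarrow> (real ^ 2 \<Rightarrow> real) \<Rightarrow> bool" where
  "level_sets_geodesic g D f \<longleftrightarrow> (\<forall>c. unparametrized_geodesic g {p \<in> D. f p = c})"

text \<open>The metric \<open>(dx\<^sup>2 + dy\<^sup>2) / (1 + \<kappa> (x\<^sup>2 + y\<^sup>2))\<^sup>2\<close>; its Gaussian curvature is \<open>4 \<kappa>\<close>.\<close>

definition const_curv_metric :: "real \<Rightarrow> metric_tensor" where
  "const_curv_metric \<kappa> p = mat (1 / (1 + \<kappa> * ((p $ 1)\<^sup>2 + (p $ 2)\<^sup>2))\<^sup>2)"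

end

theory Submission
  imports Defs
begin

text \<open>
  If a geodesic \<open>\<gamma>\<close> runs inside a level set of \<open>f\<close>, then \<open>f \<circ> \<gamma>\<close> is constant; differentiating twice,
  substituting the geodesic equation for \<open>\<gamma>''\<close> and using that \<open>\<gamma>'\<close> is proportional to \<open>(f\<^sub>y, -f\<^sub>x)\<close>
  gives the equation. Conversely, the unit tangent field of the level sets is
  \<open>W = (u / \<bar>\<nabla>f\<bar>) (f\<^sub>y, -f\<^sub>x)\<close> with \<open>u = 1 + \<kappa> (x\<^sup>2 + y\<^sup>2)\<close>, and the equation says exactly that
  \<open>W\<close> has vanishing covariant derivative along itself, so its integral curves are geodesics.
  That a level set is locally the trace of such a curve needs no existence theorem for differential
  equations: the inverse function theorem parametrizes it, and a primitive gives the arc length.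
\<close>

section \<open>Partial derivatives and the chain rule along curves\<close>

lemma has_derivative_pderiv_at:
  assumes "f differentiable (at q)"
  shows "(f has_derivative (\<lambda>h. h $ 1 * pderiv_at 1 f q + h $ 2 * pderiv_at 2 f q)) (at q)"
proof -
  have D: "(f has_derivative frechet_derivative f (at q)) (at q)"
    using assms frechet_derivative_works by blast
  then interpret bounded_linear "frechet_derivative f (at q)"
    by (rule has_derivative_bounded_linear)
  have "frechet_derivative f (at q) h = h $ 1 * pderiv_at 1 f q + h $ 2 * pderiv_at 2 f q" for h :: "real ^ 2"
  proof -
    have "h = h $ 1 *\<^sub>R axis 1 1 + h $ 2 *\<^sub>R axis 2 1"
      by (simp add: vec_eq_iff forall_2 axis_def)
    then have "frechet_derivative f (at q) h
        = frechet_derivative f (at q) (h $ 1 *\<^sub>R axis 1 1 + h $ 2 *\<^sub>R axis 2 1)"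
      by simp
    then show ?thesis
      by (simp only: add scaleR real_scaleR_def pderiv_at_def)
  qed
  then have "frechet_derivative f (at q) = (\<lambda>h. h $ 1 * pderiv_at 1 f q + h $ 2 * pderiv_at 2 f q)"
    by blast
  with D show ?thesis by simp
qed

lemma pderiv_at_eqI:
  assumes "(f has_derivative f') (at q)"
  shows "pderiv_at i f q = f' (axis i 1)"
  unfolding pderiv_at_def using frechet_derivative_at[OF assms] by simp

lemma has_real_derivative_along_curve:
  assumes "f differentiable (at (\<gamma> t))" and "(\<gamma> has_vector_derivative v) (at t)"
  shows "((\<lambda>s. f (\<gamma> s)) has_real_derivative
            v $ 1 * pderiv_at 1 f (\<gamma> t) + v $ 2 * pderiv_at 2 f (\<gamma> t)) (at t)"
proof -
  have "((\<lambda>s. f (\<gamma> s)) has_derivative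
     (\<lambda>h. (h *\<^sub>R v) $ 1 * pderiv_at 1 f (\<gamma> t) + (h *\<^sub>R v) $ 2 * pderiv_at 2 f (\<gamma> t))) (at t)"
    using has_derivative_compose[OF assms(2)[unfolded has_vector_derivative_def]
        has_derivative_pderiv_at[OF assms(1)]] by simp
  then show ?thesis
    unfolding has_field_derivative_def by (rule has_derivative_eq_rhs) (auto simp: algebra_simps)
qed

section \<open>Symmetry of second partial derivatives\<close>

text \<open>The mean value theorem is used twice: in \<open>s\<close> for the increment of
  \<open>f\<close> in direction \<open>j\<close>, then in \<open>t\<close> for the resulting
  increment of \<open>pderiv_at i f\<close>. The second difference is symmetric in \<open>i\<close>
  and \<open>j\<close>, while the derivative on the right has a fixed order; comparing the two
  orders yields \<open>pderiv_at_commute\<close>.\<close>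

lemma second_difference_mvt:
  fixes f :: "real ^ 2 \<Rightarrow> real"
  assumes f: "\<And>q. q \<in> ball p r \<Longrightarrow> f differentiable (at q)"
    and fi: "\<And>q. q \<in> ball p r \<Longrightarrow> pderiv_at i f differentiable (at q)"
    and h: "0 < h" "2 * h < r"
  obtains q where "q \<in> cball p (2 * h)"
    "f (p + h *\<^sub>R axis i 1 + h *\<^sub>R axis j 1) - f (p + h *\<^sub>R axis i 1) - f (p + h *\<^sub>R axis j 1) + f p
       = h\<^sup>2 * pderiv_at j (pderiv_at i f) q"
proof -
  \<comment> \<open>The triangle inequality gives the radius \<open>2 * h\<close>, also when
    \<open>i = j\<close>.\<close>
  have near: "p + s *\<^sub>R axis i 1 + t *\<^sub>R axis j 1 \<in> cball p (2 * h)" if "s \<in> {0..h}" "t \<in> {0..h}" for s t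
  proof -
    have "norm (s *\<^sub>R axis i 1 + t *\<^sub>R axis j (1::real)) \<le> \<bar>s\<bar> + \<bar>t\<bar>"
      using norm_triangle_ineq[of "s *\<^sub>R axis i (1::real)" "t *\<^sub>R axis j 1"] by simp
    with that have "norm (s *\<^sub>R axis i 1 + t *\<^sub>R axis j (1::real)) \<le> 2 * h" by auto
    moreover have "dist p (p + s *\<^sub>R axis i 1 + t *\<^sub>R axis j 1) = norm (s *\<^sub>R axis i 1 + t *\<^sub>R axis j (1::real))"
      by (metis add.assoc add_diff_cancel_left' dist_commute dist_norm)
    ultimately show ?thesis by simp
  qed
  have der: "((\<lambda>s. F (a + s *\<^sub>R axis k 1)) has_real_derivative pderiv_at k F (a + s *\<^sub>R axis k 1)) (at s)"
    if "F differentiable (at (a + s *\<^sub>R axis k 1))" for F a k s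
  proof -
    have "((\<lambda>s. a + s *\<^sub>R axis k (1::real)) has_vector_derivative axis k 1) (at s)"
      by (auto intro!: derivative_eq_intros simp: has_vector_derivative_def)
    from has_real_derivative_along_curve[OF that this] show ?thesis
      using exhaust_2[of k] by (auto simp: axis_def)
  qed
  have sub: "cball p (2 * h) \<subseteq> ball p r" using h by auto
  let ?G = "\<lambda>s. f ((p + h *\<^sub>R axis j 1) + s *\<^sub>R axis i 1) - f (p + s *\<^sub>R axis i 1)"
  have "(?G has_real_derivative pderiv_at i f ((p + h *\<^sub>R axis j 1) + s *\<^sub>R axis i 1)
           - pderiv_at i f (p + s *\<^sub>R axis i 1)) (at s)" if "0 \<le> s" "s \<le> h" for s
  proof (intro DERIV_diff der f)
    show "(p + h *\<^sub>R axis j 1) + s *\<^sub>R axis i 1 \<in> ball p r"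
      using near[of s h] sub that h by (auto simp: algebra_simps)
    show "p + s *\<^sub>R axis i 1 \<in> ball p r" using near[of s 0] sub that h by auto
  qed
  from MVT2[OF h(1) this] obtain s where s: "0 < s" "s < h"
    "?G h - ?G 0 = h * (pderiv_at i f (p + h *\<^sub>R axis j 1 + s *\<^sub>R axis i 1) - pderiv_at i f (p + s *\<^sub>R axis i 1))"
    by auto
  let ?H = "\<lambda>t. pderiv_at i f ((p + s *\<^sub>R axis i 1) + t *\<^sub>R axis j 1)"
  have "(?H has_real_derivative pderiv_at j (pderiv_at i f) ((p + s *\<^sub>R axis i 1) + t *\<^sub>R axis j 1)) (at t)"
    if "0 \<le> t" "t \<le> h" for t
    by (intro der fi) (use near[of s t] sub that s in auto)
  from MVT2[OF h(1) this] obtain t where t: "0 < t" "t < h"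
    "?H h - ?H 0 = h * pderiv_at j (pderiv_at i f) ((p + s *\<^sub>R axis i 1) + t *\<^sub>R axis j 1)"
    by auto
  show thesis
  proof (rule that)
    show "(p + s *\<^sub>R axis i 1) + t *\<^sub>R axis j 1 \<in> cball p (2 * h)" using near s t by auto
    show "f (p + h *\<^sub>R axis i 1 + h *\<^sub>R axis j 1) - f (p + h *\<^sub>R axis i 1) - f (p + h *\<^sub>R axis j 1) + f p
       = h\<^sup>2 * pderiv_at j (pderiv_at i f) ((p + s *\<^sub>R axis i 1) + t *\<^sub>R axis j 1)"
      using s(3) t(3) by (simp add: power2_eq_square algebra_simps)
  qed
qed

text \<open>Divided by \<open>h\<^sup>2\<close>, the second difference equals a mixed derivative at
  a point that tends to \<open>p\<close>. By continuity it converges to the mixed derivative at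
  \<open>p\<close>, in either order, and limits are unique.\<close>

lemma pderiv_at_commute:
  assumes S: "open S" "p \<in> S" and C2: "Ck_on 2 f S"
  shows "pderiv_at j (pderiv_at i f) p = pderiv_at i (pderiv_at j f) p"
proof -
  from S obtain r where r: "r > 0" "ball p r \<subseteq> S" using open_contains_ball by blast
  have d: "f differentiable (at q)" "pderiv_at k f differentiable (at q)" if "q \<in> ball p r" for q k
    using C2 r that by (auto simp: numeral_2_eq_2)
  have c: "isCont (pderiv_at l (pderiv_at k f)) p" for k l
  proof -
    have "continuous_on S (pderiv_at l (pderiv_at k f))"
      using C2 by (simp add: numeral_2_eq_2)
    then show ?thesis using S continuous_on_eq_continuous_at by blast
  qed
  \<comment> \<open>A positive null sequence; the factor 3 makes \<open>2 * h n < r\<close> hold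
    already for the first term, \<open>2 * h 0 = 2 * r / 3\<close>.\<close>
  define h where "h n = r / (3 * real (Suc n))" for n
  have h: "0 < h n" "2 * h n < r" for n
  proof -
    show "0 < h n" using r by (simp add: h_def)
    show "2 * h n < r" using r by (simp add: h_def divide_less_eq)
  qed
  have "(\<lambda>n. (2 * r / 3) * inverse (real (Suc n))) \<longlonglongrightarrow> (2 * r / 3) * 0"
    by (intro tendsto_intros LIMSEQ_inverse_real_of_nat)
  then have h0: "(\<lambda>n. 2 * h n) \<longlonglongrightarrow> 0"
    by (simp add: h_def field_simps)
  let ?\<Delta> = "\<lambda>i j h. f (p + h *\<^sub>R axis i 1 + h *\<^sub>R axis j 1) - f (p + h *\<^sub>R axis i 1) - f (p + h *\<^sub>R axis j 1) + f p"
  have lim: "(\<lambda>n. ?\<Delta> k l (h n) / (h n)\<^sup>2) \<longlonglongrightarrow> pderiv_at l (pderiv_at k f) p" for k l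
  proof -
    have "\<exists>q. q \<in> cball p (2 * h n) \<and> ?\<Delta> k l (h n) = (h n)\<^sup>2 * pderiv_at l (pderiv_at k f) q" for n
      using second_difference_mvt[where p = p and r = r and f = f and i = k and h = "h n" and j = l, OF d h] by metis
    then obtain q where q: "\<And>n. q n \<in> cball p (2 * h n)"
      "\<And>n. ?\<Delta> k l (h n) = (h n)\<^sup>2 * pderiv_at l (pderiv_at k f) (q n)" by metis
    have "dist (q n) p \<le> 2 * h n" for n
      using q(1)[of n] by (simp only: mem_cball dist_commute)
    then have "(\<lambda>n. dist (q n) p) \<longlonglongrightarrow> 0"
      using tendsto_sandwich[of "\<lambda>n. 0" "\<lambda>n. dist (q n) p" sequentially "\<lambda>n. 2 * h n" 0] h0 by simp
    then have "q \<longlonglongrightarrow> p" by (rule tendsto_dist_iff[THEN iffD2])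
    then have "(\<lambda>n. pderiv_at l (pderiv_at k f) (q n)) \<longlonglongrightarrow> pderiv_at l (pderiv_at k f) p"
      by (rule isCont_tendsto_compose[OF c])
    moreover have "?\<Delta> k l (h n) / (h n)\<^sup>2 = pderiv_at l (pderiv_at k f) (q n)" for n
      unfolding q(2) using h(1)[of n] by simp
    ultimately show ?thesis by (simp only:)
  qed
  have "?\<Delta> i j = ?\<Delta> j i" by (simp add: fun_eq_iff add_ac)
  with lim[of i j] have "(\<lambda>n. ?\<Delta> j i (h n) / (h n)\<^sup>2) \<longlonglongrightarrow> pderiv_at j (pderiv_at i f) p"
    by (simp only: fun_eq_iff)
  from LIMSEQ_unique[OF this lim[of j i]] show ?thesis .
qed

section \<open>The Levi-Civita connection of the conformally flat metric\<close>

lemma matrix_inv_mat: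
  assumes "c \<noteq> (0::real)"
  shows "matrix_inv (mat c :: real ^ 'n ^ 'n) = mat (1 / c)"
proof -
  have mm: "(mat a :: real ^ 'n ^ 'n) ** mat b = mat (a * b)" for a b
  proof -
    have "(if i = k then a else 0) * (if k = j then b else 0) = (if i = k then if i = j then a * b else 0 else 0)"
      for i j k :: 'n by auto
    then show ?thesis
      by (simp add: matrix_matrix_mult_def mat_def vec_eq_iff)
  qed
  have "(mat c :: real ^ 'n ^ 'n) ** mat (1 / c) = mat 1" "(mat (1 / c) :: real ^ 'n ^ 'n) ** mat c = mat 1"
    using assms by (simp_all add: mm)
  \<comment> \<open>\<open>matrix_inv\<close> is a choice among two-sided inverses, so their
    uniqueness has to be shown as well.\<close>
  then show ?thesis
    unfolding matrix_inv_def
    by (intro some_equality) (auto, metis matrix_mul_assoc matrix_mul_lid matrix_mul_rid)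
qed

text \<open>The metric is the Euclidean one divided by the square of this function, called
  \<open>u\<close> in the overview.\<close>

definition conf_denom :: "real \<Rightarrow> real ^ 2 \<Rightarrow> real" where
  "conf_denom \<kappa> p = 1 + \<kappa> * ((p $ 1)\<^sup>2 + (p $ 2)\<^sup>2)"

lemma has_derivative_conf_denom:
  "(conf_denom \<kappa> has_derivative (\<lambda>h. 2 * \<kappa> * (p $ 1 * h $ 1 + p $ 2 * h $ 2))) (at p)"
proof -
  have c: "((\<lambda>q :: real ^ 2. q $ i) has_derivative (\<lambda>h. h $ i)) (at p)" for i
    by (intro bounded_linear_imp_has_derivative bounded_linear_vec_nth)
  have "((\<lambda>q. 1 + \<kappa> * ((q $ 1)\<^sup>2 + (q $ 2)\<^sup>2)) has_derivative
      (\<lambda>h. 2 * \<kappa> * (p $ 1 * h $ 1 + p $ 2 * h $ 2))) (at p)"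
    by (rule derivative_eq_intros c refl)+ (auto simp: fun_eq_iff algebra_simps)
  then show ?thesis by (simp add: conf_denom_def[abs_def])
qed

text \<open>For the Euclidean metric scaled by \<open>exp (2 * \<phi>)\<close> the symbols are
  \<delta>_jk d_i \<phi> + \<delta>_ik d_j \<phi> - \<delta>_ij d_k \<phi>. Here \<phi> = - ln |u|,
  whose partial derivatives are -2 \<kappa> x_i / u.\<close>

lemma christoffel_const_curv_metric:
  assumes u: "conf_denom \<kappa> p \<noteq> 0"
  shows "christoffel (const_curv_metric \<kappa>) k i j p =
    - 2 * \<kappa> / conf_denom \<kappa> p *
      ((if j = k then p $ i else 0) + (if i = k then p $ j else 0) - (if i = j then p $ k else 0))"
proof -
  let ?u = "conf_denom \<kappa> p"
  have g: "const_curv_metric \<kappa> q = mat (1 / (conf_denom \<kappa> q)\<^sup>2)" for q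
    by (simp add: const_curv_metric_def conf_denom_def)
  have "((\<lambda>q. 1 / (conf_denom \<kappa> q)\<^sup>2) has_derivative
      (\<lambda>h. - 4 * \<kappa> * (p $ 1 * h $ 1 + p $ 2 * h $ 2) / ?u ^ 3)) (at p)"
    by (rule derivative_eq_intros has_derivative_conf_denom refl | use u in \<open>simp; fail\<close>)+
      (use u in \<open>auto simp: fun_eq_iff power2_eq_square power3_eq_cube divide_simps\<close>)
  note d\<phi> = pderiv_at_eqI[OF this]
  have d: "pderiv_at l (\<lambda>q. const_curv_metric \<kappa> q $ m $ n) p =
      (if m = n then - 4 * \<kappa> * p $ l / ?u ^ 3 else 0)" for l m n
  proof (cases "m = n")
    case True
    then show ?thesis
      using exhaust_2[of l] by (auto simp: g mat_def d\<phi>) (auto simp: axis_def)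
  next
    case False
    have "((\<lambda>q::real^2. 0::real) has_derivative (\<lambda>h. 0)) (at p)" by simp
    from pderiv_at_eqI[OF this] False show ?thesis
      by (simp add: g mat_def)
  qed
  have inv: "matrix_inv (const_curv_metric \<kappa> p) = mat (?u\<^sup>2)"
    using u matrix_inv_mat[of "1 / ?u\<^sup>2"] by (simp add: g)
  have "christoffel (const_curv_metric \<kappa>) k i j p = ?u\<^sup>2 *
      ((if j = k then - 4 * \<kappa> * p $ i / ?u ^ 3 else 0) + (if i = k then - 4 * \<kappa> * p $ j / ?u ^ 3 else 0)
        - (if i = j then - 4 * \<kappa> * p $ k / ?u ^ 3 else 0)) / 2"
    unfolding christoffel_def d inv
    using exhaust_2[of k] by (auto simp: mat_def sum_2)
  also have "\<dots> = - 2 * \<kappa> / ?u *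
      ((if j = k then p $ i else 0) + (if i = k then p $ j else 0) - (if i = j then p $ k else 0))"
    using u by (auto simp: divide_simps power2_eq_square power3_eq_cube)
  finally show ?thesis .
qed

text \<open>Contracting the symbols twice with the velocity v at the position p leaves 2 (p . v) v -
  |v|^2 p, with Euclidean products, times -2 \<kappa> / u. Both directions of the equivalence use
  this form.\<close>

lemma cov_acceleration_const_curv_metric:
  assumes u: "conf_denom \<kappa> (\<gamma> t) \<noteq> 0"
  shows "cov_acceleration (const_curv_metric \<kappa>) \<gamma> t $ k =
    vector_derivative (velocity \<gamma>) (at t) $ k
     - 2 * \<kappa> / conf_denom \<kappa> (\<gamma> t) *
       (2 * (\<gamma> t $ 1 * velocity \<gamma> t $ 1 + \<gamma> t $ 2 * velocity \<gamma> t $ 2) * velocity \<gamma> t $ k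
         - ((velocity \<gamma> t $ 1)\<^sup>2 + (velocity \<gamma> t $ 2)\<^sup>2) * \<gamma> t $ k)"
proof -
  have "k = 1 \<or> k = 2" by (rule exhaust_2)
  then show ?thesis
    using u unfolding cov_acceleration_def
    by (auto simp: sum_2 christoffel_const_curv_metric)
      (auto simp: divide_simps power2_eq_square algebra_simps)
qed

section \<open>Parametrizing level sets by curves of prescribed velocity\<close>

text \<open>The map \<open>\<Phi>\<close> with components \<open>l\<close> and \<open>f\<close> is a
  local diffeomorphism at \<open>p\<close>, and it takes the level set of \<open>f\<close> to a
  horizontal line. The inverse image of a segment of that line is the curve; its speed factor
  \<open>m\<close> is whatever comes out and is corrected later.\<close>

lemma level_curve_parametrization:
  fixes f :: "real ^ 2 \<Rightarrow> real"
  defines "tangent \<equiv> \<lambda>q. pderiv_at 2 f q *\<^sub>R axis 1 1 - pderiv_at 1 f q *\<^sub>R axis 2 1 :: real ^ 2"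
  assumes D: "open D" "p \<in> D"
    and diff: "\<And>q. q \<in> D \<Longrightarrow> f differentiable (at q)"
    and cont: "\<And>i. continuous_on D (pderiv_at i f)"
    and regular: "pderiv_at 1 f p \<noteq> 0 \<or> pderiv_at 2 f p \<noteq> 0"
  obtains U \<beta> a b m where "open U" "p \<in> U" "U \<subseteq> D"
    "\<beta> ` {a<..<b} = {q \<in> U. f q = f p}"
    "\<forall>\<tau>\<in>{a<..<b}. (\<beta> has_vector_derivative m \<tau> *\<^sub>R tangent (\<beta> \<tau>)) (at \<tau>)"
    "continuous_on {a<..<b} m" "\<forall>\<tau>\<in>{a<..<b}. m \<tau> \<noteq> 0"
proof -
  let ?a = "pderiv_at 1 f p" and ?b = "pderiv_at 2 f p"
  \<comment> \<open>\<open>l\<close> is the linear form of the tangent direction at \<open>p\<close>: no case split on which partial derivative is nonzero.\<close>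
  define l where "l q = ?b * q $ 1 - ?a * q $ 2" for q :: "real ^ 2"
  define \<Phi> where "\<Phi> q = (l q *\<^sub>R axis 1 1 + f q *\<^sub>R axis 2 1 :: real ^ 2)" for q
  let ?N = "?a\<^sup>2 + ?b\<^sup>2"
  have N: "?N \<noteq> 0" using regular by (simp add: sum_power2_eq_zero_iff)
  have l: "bounded_linear l"
    unfolding l_def[abs_def] by (intro bounded_linear_intros bounded_linear_vec_nth)
  \<comment> \<open>The inverse function theorem asks for a continuous field of bounded linear maps.
    Writing \<open>\<Phi>'\<close> as a combination of the constant maps \<open>A\<close>,
    \<open>B\<close>, \<open>C\<close> reduces this to continuity of the partial
    derivatives.\<close>
  define A where "A = Blinfun (\<lambda>h :: real ^ 2. h $ 1 *\<^sub>R axis 2 1 :: real ^ 2)"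
  define B where "B = Blinfun (\<lambda>h :: real ^ 2. h $ 2 *\<^sub>R axis 2 1 :: real ^ 2)"
  define C where "C = Blinfun (\<lambda>h :: real ^ 2. l h *\<^sub>R axis 1 1 :: real ^ 2)"
  \<comment> \<open>The inverse of the derivative at \<open>p\<close>: that derivative has rows (b,
    -a) and (a, b), hence determinant \<open>?N\<close>.\<close>
  define E where "E = Blinfun (\<lambda>h :: real ^ 2. ((?b * h $ 1 + ?a * h $ 2) / ?N) *\<^sub>R axis 1 1
      + ((?b * h $ 2 - ?a * h $ 1) / ?N) *\<^sub>R axis 2 1 :: real ^ 2)"
  have A: "blinfun_apply A h = h $ 1 *\<^sub>R axis 2 1" for h
    unfolding A_def by (subst bounded_linear_Blinfun_apply) (intro bounded_linear_intros bounded_linear_vec_nth refl)+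
  have B: "blinfun_apply B h = h $ 2 *\<^sub>R axis 2 1" for h
    unfolding B_def by (subst bounded_linear_Blinfun_apply) (intro bounded_linear_intros bounded_linear_vec_nth refl)+
  have C: "blinfun_apply C h = l h *\<^sub>R axis 1 1" for h
    unfolding C_def by (subst bounded_linear_Blinfun_apply) (intro bounded_linear_intros l refl)+
  have E: "blinfun_apply E h = ((?b * h $ 1 + ?a * h $ 2) / ?N) *\<^sub>R axis 1 1
      + ((?b * h $ 2 - ?a * h $ 1) / ?N) *\<^sub>R axis 2 1" for h
    unfolding E_def divide_inverse
    by (subst bounded_linear_Blinfun_apply) (intro bounded_linear_intros bounded_linear_vec_nth refl)+
  define \<Phi>' where "\<Phi>' q = pderiv_at 1 f q *\<^sub>R A + pderiv_at 2 f q *\<^sub>R B + C" for q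
  have \<Phi>': "blinfun_apply (\<Phi>' q) h = l h *\<^sub>R axis 1 1
      + (h $ 1 * pderiv_at 1 f q + h $ 2 * pderiv_at 2 f q) *\<^sub>R axis 2 1" for q h
    by (simp add: \<Phi>'_def A B C blinfun.add_left blinfun.scaleR_left algebra_simps)
  have der: "(\<Phi> has_derivative blinfun_apply (\<Phi>' q)) (at q)" if "q \<in> D" for q
    unfolding \<Phi>_def[abs_def]
    by (rule derivative_eq_intros bounded_linear_imp_has_derivative[OF l]
          has_derivative_pderiv_at[OF diff[OF that]] refl)+ (simp add: \<Phi>' fun_eq_iff)
  have cont': "continuous_on D \<Phi>'"
    unfolding \<Phi>'_def by (intro continuous_intros cont)
  have "E o\<^sub>L \<Phi>' p = id_blinfun"
  proof (rule blinfun_eqI)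
    fix h :: "real ^ 2"
    have "?b * l h + ?a * (h $ 1 * ?a + h $ 2 * ?b) = ?N * h $ 1"
      "?b * (h $ 1 * ?a + h $ 2 * ?b) - ?a * l h = ?N * h $ 2"
      by (simp_all add: l_def algebra_simps power2_eq_square)
    with N show "blinfun_apply (E o\<^sub>L \<Phi>' p) h = blinfun_apply id_blinfun h"
      by (simp add: E \<Phi>' vec_eq_iff forall_2 axis_def)
  qed
  from inverse_function_theorem[OF D(1) der cont' D(2) this]
  obtain U V g g' where U: "open U" "U \<subseteq> D" "p \<in> U" and V: "open V" "\<Phi> p \<in> V"
    and hom: "homeomorphism U V \<Phi> g"
    and g: "\<And>y. y \<in> V \<Longrightarrow> (g has_derivative g' y) (at y)"
      "\<And>y. y \<in> V \<Longrightarrow> g' y = inv (blinfun_apply (\<Phi>' (g y)))"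
      "\<And>y. y \<in> V \<Longrightarrow> bij (blinfun_apply (\<Phi>' (g y)))"
    by metis
  obtain e where e: "e > 0" "ball (\<Phi> p) e \<subseteq> V" using V open_contains_ball by blast
  \<comment> \<open>The horizontal line through \<open>\<Phi> p\<close>, parametrized by the value
    of \<open>l\<close>; \<open>J\<close> keeps it inside the ball around
    \<open>\<Phi> p\<close>.\<close>
  define y where "y \<tau> = (\<tau> *\<^sub>R axis 1 1 + f p *\<^sub>R axis 2 1 :: real ^ 2)" for \<tau>
  define J where "J = {l p - e<..<l p + e}"
  have y: "y \<tau> \<in> V" if "\<tau> \<in> J" for \<tau>
  proof -
    have "\<Phi> p - y \<tau> = (l p - \<tau>) *\<^sub>R axis 1 1" by (simp add: \<Phi>_def y_def algebra_simps)
    then have "dist (\<Phi> p) (y \<tau>) = \<bar>l p - \<tau>\<bar>" by (simp add: dist_norm)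
    with that e show ?thesis by (auto simp: J_def)
  qed
  have \<Phi>g: "\<Phi> (g (y \<tau>)) = y \<tau>" "g (y \<tau>) \<in> U" if "\<tau> \<in> J" for \<tau>
    using hom y[OF that] by (auto simp: homeomorphism_def)
  have lf: "l (g (y \<tau>)) = \<tau>" "f (g (y \<tau>)) = f p" if "\<tau> \<in> J" for \<tau>
    using arg_cong[OF \<Phi>g(1)[OF that], of "\<lambda>q. q $ 1"] arg_cong[OF \<Phi>g(1)[OF that], of "\<lambda>q. q $ 2"]
    by (auto simp: \<Phi>_def y_def axis_def)
  \<comment> \<open>Restricting \<open>U\<close> to points with \<open>l\<close> in \<open>J\<close>
    makes the curve cover the whole level set in the neighbourhood.\<close>
  define W where "W = U \<inter> l -` J"
  \<comment> \<open>The determinant of \<open>\<Phi>' q\<close>.\<close>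
  define k where "k q = ?b * pderiv_at 2 f q + ?a * pderiv_at 1 f q" for q
  have W1: "open W"
    unfolding W_def J_def using U(1) linear_continuous_on[OF l]
    by (intro open_Int open_vimage) auto
  have W2: "p \<in> W" using U e by (auto simp: W_def J_def)
  have W3: "W \<subseteq> D" using U by (auto simp: W_def)
  have W4: "(\<lambda>\<tau>. g (y \<tau>)) ` J = {q \<in> W. f q = f p}"
  proof (intro equalityI subsetI)
    fix q assume "q \<in> {q \<in> W. f q = f p}"
    then have q: "q \<in> U" "l q \<in> J" "\<Phi> q = y (l q)" by (auto simp: W_def \<Phi>_def y_def)
    then have "q = g (y (l q))" using hom by (metis homeomorphism_apply1)
    with q show "q \<in> (\<lambda>\<tau>. g (y \<tau>)) ` J" by blast
  qed (use \<Phi>g lf in \<open>auto simp: W_def\<close>)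
  have \<beta>': "k (g (y \<tau>)) \<noteq> 0 \<and>
    ((\<lambda>\<tau>. g (y \<tau>)) has_vector_derivative (1 / k (g (y \<tau>))) *\<^sub>R tangent (g (y \<tau>))) (at \<tau>)"
    if "\<tau> \<in> J" for \<tau>
  proof -
    let ?q = "g (y \<tau>)"
    define w where "w = g' (y \<tau>) (axis 1 1)"
    have "(y has_vector_derivative axis 1 1) (at \<tau>)"
      unfolding y_def[abs_def] by (auto intro!: derivative_eq_intros simp: has_vector_derivative_def)
    from vector_derivative_diff_chain_within[OF this, of g "g' (y \<tau>)"] g(1)[OF y[OF that]]
    have d: "((\<lambda>\<tau>. g (y \<tau>)) has_vector_derivative w) (at \<tau>)"
      by (auto simp: o_def w_def intro: has_derivative_at_withinI)
    have "blinfun_apply (\<Phi>' ?q) w = axis 1 1"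
      unfolding w_def g(2)[OF y[OF that]]
      using g(3)[OF y[OF that]] by (simp add: bij_is_surj surj_f_inv_f)
    from arg_cong[OF this, of "\<lambda>q. q $ 1"] arg_cong[OF this, of "\<lambda>q. q $ 2"]
    have w: "?b * w $ 1 - ?a * w $ 2 = 1" "w $ 1 * pderiv_at 1 f ?q + w $ 2 * pderiv_at 2 f ?q = 0"
      by (auto simp: \<Phi>' l_def axis_def)
    \<comment> \<open>Cramer's rule for the two linear equations in \<open>w\<close>.\<close>
    have "w $ 1 * k ?q = pderiv_at 2 f ?q * (?b * w $ 1 - ?a * w $ 2)
        + ?a * (w $ 1 * pderiv_at 1 f ?q + w $ 2 * pderiv_at 2 f ?q)"
      "w $ 2 * k ?q = - pderiv_at 1 f ?q * (?b * w $ 1 - ?a * w $ 2)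
        + ?b * (w $ 1 * pderiv_at 1 f ?q + w $ 2 * pderiv_at 2 f ?q)"
      by (simp_all add: k_def algebra_simps)
    then have kw: "w $ 1 * k ?q = pderiv_at 2 f ?q" "w $ 2 * k ?q = - pderiv_at 1 f ?q"
      unfolding w by simp_all
    have "k ?q \<noteq> 0"
    proof
      \<comment> \<open>A zero determinant would make both partial derivatives vanish at
        \<open>?q\<close>; then \<open>\<Phi>'\<close> would kill the gradient at \<open>p\<close>,
        on which \<open>l\<close> is zero, although it is injective.\<close>
      assume k0: "k ?q = 0"
      then have "pderiv_at 1 f ?q = 0" "pderiv_at 2 f ?q = 0" using kw by auto
      then have "blinfun_apply (\<Phi>' ?q) (?a *\<^sub>R axis 1 1 + ?b *\<^sub>R axis 2 1) = blinfun_apply (\<Phi>' ?q) 0"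
        by (simp add: \<Phi>' l_def axis_def)
      then have "?a *\<^sub>R axis 1 1 + ?b *\<^sub>R axis 2 1 = (0 :: real ^ 2)"
        using g(3)[OF y[OF that]] by (meson bij_is_inj injD)
      with N show False by (simp add: vec_eq_iff forall_2 axis_def)
    qed
    then have "w = (1 / k ?q) *\<^sub>R tangent ?q"
      using kw by (auto simp: vec_eq_iff forall_2 axis_def tangent_def field_simps)
    with d \<open>k ?q \<noteq> 0\<close> show ?thesis by simp
  qed
  have W5: "continuous_on J (\<lambda>\<tau>. 1 / k (g (y \<tau>)))"
  proof -
    have "continuous_on J (\<lambda>\<tau>. g (y \<tau>))"
      using \<beta>' by (auto intro!: continuous_at_imp_continuous_on has_vector_derivative_continuous)
    then have "continuous_on J (\<lambda>\<tau>. pderiv_at i f (g (y \<tau>)))" for i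
      using \<Phi>g U by (intro continuous_on_compose2[OF cont]) auto
    then show ?thesis
      using \<beta>' unfolding k_def by (intro continuous_intros) (auto simp: k_def)
  qed
  show thesis
    by (rule that[OF W1 W2 W3 W4[unfolded J_def] _ W5[unfolded J_def]]) (use \<beta>' in \<open>simp_all add: J_def\<close>)
qed

text \<open>Separation of variables: \<open>T\<close> is the inverse of a primitive \<open>s\<close>
  of \<open>1 / \<psi>\<close>, so its derivative is \<open>\<psi>\<close> at
  \<open>T t\<close>.\<close>

lemma separable_ode_reparametrization:
  fixes \<psi> :: "real \<Rightarrow> real"
  assumes \<psi>: "continuous_on {a<..<b} \<psi>" "\<And>x. x \<in> {a<..<b} \<Longrightarrow> \<psi> x \<noteq> 0"
  obtains I T where "open I" "is_interval I" "T ` I = {a<..<b}"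
    "\<forall>t\<in>I. (T has_real_derivative \<psi> (T t)) (at t)"
proof (cases "a < b")
  case False
  then show thesis using that[of "{}"] by auto
next
  case True
  let ?J = "{a<..<b}"
  have "isCont (\<lambda>x. 1 / \<psi> x) x" if "x \<in> ?J" for x
    using continuous_on_eq_continuous_at[of ?J \<psi>] \<psi> that by (intro continuous_intros) auto
  then obtain s where "\<And>x. x \<in> ?J \<Longrightarrow> (s has_vector_derivative 1 / \<psi> x) (at x)"
    using einterval_antiderivative[of "ereal a" "ereal b" "\<lambda>x. 1 / \<psi> x"] True by auto
  then have s: "(s has_real_derivative 1 / \<psi> x) (at x)" if "x \<in> ?J" for x
    using that by (simp add: has_real_derivative_iff_has_vector_derivative)
  have contJ: "continuous_on ?J s"
    using s by (meson DERIV_isCont continuous_at_imp_continuous_on)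
  \<comment> \<open>A nonvanishing derivative gives injectivity by the mean value theorem, with no
    case split on the sign of \<open>\<psi>\<close>.\<close>
  have neq: "s x \<noteq> s y" if xy: "x \<in> ?J" "y \<in> ?J" "x < y" for x y
  proof
    assume "s x = s y"
    have "(s has_real_derivative 1 / \<psi> z) (at z)" if "x \<le> z" "z \<le> y" for z
      using that xy by (intro s) auto
    from MVT2[OF xy(3) this] obtain z where "x < z" "z < y" "s y - s x = (y - x) * (1 / \<psi> z)" by auto
    with \<open>s x = s y\<close> \<psi>(2)[of z] xy show False by auto
  qed
  then have inj: "inj_on s ?J"
    by (metis inj_onI linorder_less_linear)
  define T where "T = inv_into ?J s"
  have T: "T (s x) = x" if "x \<in> ?J" for x using inv_into_f_f[OF inj that] by (simp add: T_def)
  show thesis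
  proof (rule that[of "s ` ?J" T])
    show "open (s ` ?J)" by (rule invariance_of_domain[OF contJ _ inj]) auto
    show "is_interval (s ` ?J)"
      using contJ by (simp add: is_interval_connected_1 connected_continuous_image)
    show "T ` s ` ?J = ?J" using T by force
    show "\<forall>t\<in>s ` ?J. (T has_real_derivative \<psi> (T t)) (at t)"
    proof
      fix t assume "t \<in> s ` ?J"
      then obtain x where x: "x \<in> ?J" "t = s x" by auto
      have "(s has_derivative (\<lambda>h. 1 / \<psi> z * h)) (at z)" if "z \<in> ?J" for z
        using s[OF that] by (simp only: has_field_derivative_def)
      from has_derivative_inverse_on[OF _ this T _ x(1), where g' = "\<lambda>z h. \<psi> z * h"]
      have "(T has_derivative (\<lambda>h. \<psi> x * h)) (at (s x))"
        using \<psi>(2) x by (simp add: fun_eq_iff)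
      then show "(T has_real_derivative \<psi> (T t)) (at t)"
        using T x by (simp add: has_field_derivative_def)
    qed
  qed
qed

text \<open>Reparametrizing \<open>\<beta>\<close> by a solution of T' = \<rho>(\<beta>(T)) / m(T)
  cancels \<open>m\<close> and leaves the speed factor \<open>\<rho>\<close>, which can thus be
  chosen to suit the geodesic equation.\<close>

lemma level_set_integral_curve:
  fixes f \<rho> :: "real ^ 2 \<Rightarrow> real"
  assumes D: "open D" "p \<in> D"
    and diff: "\<And>q. q \<in> D \<Longrightarrow> f differentiable (at q)"
    and cont: "\<And>i. continuous_on D (pderiv_at i f)"
    and regular: "pderiv_at 1 f p \<noteq> 0 \<or> pderiv_at 2 f p \<noteq> 0"
    and \<rho>: "continuous_on D \<rho>" "\<And>q. q \<in> D \<Longrightarrow> \<rho> q \<noteq> 0"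
  obtains U I \<gamma> where "open U" "p \<in> U" "U \<subseteq> D" "open I" "is_interval I"
    "\<gamma> ` I = {q \<in> U. f q = f p}"
    "\<forall>t\<in>I. (\<gamma> has_vector_derivative
       \<rho> (\<gamma> t) *\<^sub>R (pderiv_at 2 f (\<gamma> t) *\<^sub>R axis 1 1 - pderiv_at 1 f (\<gamma> t) *\<^sub>R axis 2 1)) (at t)"
proof -
  let ?n = "\<lambda>q. pderiv_at 2 f q *\<^sub>R axis 1 1 - pderiv_at 1 f q *\<^sub>R axis 2 1 :: real ^ 2"
  obtain U \<beta> a b m where U: "open U" "p \<in> U" "U \<subseteq> D"
    and im: "\<beta> ` {a<..<b} = {q \<in> U. f q = f p}"
    and \<beta>: "\<forall>\<tau>\<in>{a<..<b}. (\<beta> has_vector_derivative m \<tau> *\<^sub>R ?n (\<beta> \<tau>)) (at \<tau>)"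
    and m: "continuous_on {a<..<b} m" "\<forall>\<tau>\<in>{a<..<b}. m \<tau> \<noteq> 0"
    by (rule level_curve_parametrization[OF D diff cont regular]) (assumption | rule that)+
  have \<beta>D: "\<beta> \<tau> \<in> D" if "\<tau> \<in> {a<..<b}" for \<tau> using im U that by blast
  have "continuous_on {a<..<b} \<beta>"
    using \<beta> by (auto intro!: continuous_at_imp_continuous_on has_vector_derivative_continuous)
  then have "continuous_on {a<..<b} (\<lambda>\<tau>. \<rho> (\<beta> \<tau>))"
    using \<beta>D by (intro continuous_on_compose2[OF \<rho>(1)]) auto
  then have "continuous_on {a<..<b} (\<lambda>\<tau>. \<rho> (\<beta> \<tau>) / m \<tau>)"
    using m by (intro continuous_intros) auto
  moreover have "\<rho> (\<beta> \<tau>) / m \<tau> \<noteq> 0" if "\<tau> \<in> {a<..<b}" for \<tau>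
    using m(2) \<rho>(2) \<beta>D that by simp
  ultimately obtain I T where I: "open I" "is_interval I" "T ` I = {a<..<b}"
    and T: "\<forall>t\<in>I. (T has_real_derivative \<rho> (\<beta> (T t)) / m (T t)) (at t)"
    by (rule separable_ode_reparametrization[of a b "\<lambda>\<tau>. \<rho> (\<beta> \<tau>) / m \<tau>"]) (assumption | rule that)+
  have "((\<lambda>t. \<beta> (T t)) has_vector_derivative \<rho> (\<beta> (T t)) *\<^sub>R ?n (\<beta> (T t))) (at t)" if "t \<in> I" for t
  proof -
    have Tt: "T t \<in> {a<..<b}" using I that by blast
    have "((\<beta> \<circ> T) has_vector_derivative (\<rho> (\<beta> (T t)) / m (T t)) *\<^sub>R (m (T t) *\<^sub>R ?n (\<beta> (T t)))) (at t)"
      using bspec[OF T that] bspec[OF \<beta> Tt]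
      by (intro vector_diff_chain_at) (simp_all add: has_real_derivative_iff_has_vector_derivative)
    then show ?thesis using m(2) Tt by (simp add: o_def)
  qed
  moreover have "(\<lambda>t. \<beta> (T t)) ` I = {q \<in> U. f q = f p}"
    using im I(3) by (metis image_image)
  ultimately show thesis using that U I by blast
qed

section \<open>The equation and the geodesic property of level curves\<close>

text \<open>The left side is the Hessian of \<open>f\<close> evaluated twice on the tangent vector
  (b, -a) of the level curve.\<close>

definition geodesic_pde_at :: "real \<Rightarrow> (real ^ 2 \<Rightarrow> real) \<Rightarrow> real ^ 2 \<Rightarrow> bool" where
  "geodesic_pde_at \<kappa> f p \<longleftrightarrow>
     (let a = pderiv_at 1 f p; b = pderiv_at 2 f p
      in b\<^sup>2 * pderiv_at 1 (pderiv_at 1 f) p - 2 * a * b * pderiv_at 2 (pderiv_at 1 f) p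
           + a\<^sup>2 * pderiv_at 2 (pderiv_at 2 f) p
         = 2 * \<kappa> * (p $ 1 * a + p $ 2 * b) * (a\<^sup>2 + b\<^sup>2) / conf_denom \<kappa> p)"

text \<open>The second derivative of the constant \<open>f (\<gamma> s)\<close> is w . grad f + Hess
  f (v, v), with v the velocity and w its derivative. In the geodesic equation for w the multiple of
  v is orthogonal to the gradient, so only the multiple of the position survives and becomes the
  right side of the equation.\<close>

lemma geodesic_pde_at_level_geodesic:
  assumes D: "open D" and C2: "Ck_on 2 f D"
    and reg: "pderiv_at 1 f (\<gamma> t) \<noteq> 0 \<or> pderiv_at 2 f (\<gamma> t) \<noteq> 0"
    and u: "conf_denom \<kappa> (\<gamma> t) \<noteq> 0"
    and geo: "geodesic_on (const_curv_metric \<kappa>) I \<gamma>"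
    and I: "open I" "t \<in> I" and \<gamma>: "\<And>s. s \<in> I \<Longrightarrow> \<gamma> s \<in> D \<and> f (\<gamma> s) = c"
  shows "geodesic_pde_at \<kappa> f (\<gamma> t)"
proof -
  note C2 = C2[unfolded numeral_2_eq_2 Ck_on.simps]
  let ?fx = "pderiv_at 1 f" and ?fy = "pderiv_at 2 f" and ?v = "velocity \<gamma>"
  define w where "w = vector_derivative ?v (at t)"
  have d\<gamma>: "(\<gamma> has_vector_derivative ?v s) (at s)" if "s \<in> I" for s
    using geo that unfolding geodesic_on_def velocity_def by (simp add: vector_derivative_works)
  have dv: "(?v has_vector_derivative w) (at t)"
    using geo I unfolding geodesic_on_def w_def by (simp add: vector_derivative_works)
  have dv': "((\<lambda>s. ?v s $ i) has_real_derivative w $ i) (at t)" for i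
    using bounded_linear.has_vector_derivative[OF bounded_linear_vec_nth dv]
    by (simp add: has_real_derivative_iff_has_vector_derivative)
  have tangent: "?v s $ 1 * ?fx (\<gamma> s) + ?v s $ 2 * ?fy (\<gamma> s) = 0" if "s \<in> I" for s
  proof -
    have "((\<lambda>s. f (\<gamma> s)) has_real_derivative ?v s $ 1 * ?fx (\<gamma> s) + ?v s $ 2 * ?fy (\<gamma> s)) (at s)"
      using C2 \<gamma>[OF that] by (intro has_real_derivative_along_curve d\<gamma>[OF that]) auto
    moreover have "((\<lambda>s. f (\<gamma> s)) has_real_derivative 0) (at s)"
      by (rule has_field_derivative_transform_within_open[OF DERIV_const[of c] I(1) that]) (use \<gamma> in auto)
    ultimately show ?thesis by (rule DERIV_unique)
  qed
  let ?a = "?fx (\<gamma> t)" and ?b = "?fy (\<gamma> t)" and ?v1 = "?v t $ 1" and ?v2 = "?v t $ 2"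
    and ?u = "conf_denom \<kappa> (\<gamma> t)" and ?x = "\<gamma> t $ 1" and ?y = "\<gamma> t $ 2"
  let ?fxx = "pderiv_at 1 ?fx (\<gamma> t)" and ?fxy = "pderiv_at 2 ?fx (\<gamma> t)" and ?fyy = "pderiv_at 2 ?fy (\<gamma> t)"
  have fyx: "pderiv_at 1 ?fy (\<gamma> t) = ?fxy"
    using pderiv_at_commute[OF D _ assms(2)] \<gamma> I by blast
  have da: "((\<lambda>s. ?fx (\<gamma> s)) has_real_derivative ?v1 * ?fxx + ?v2 * ?fxy) (at t)"
    and db: "((\<lambda>s. ?fy (\<gamma> s)) has_real_derivative ?v1 * ?fxy + ?v2 * ?fyy) (at t)"
    using has_real_derivative_along_curve[OF _ d\<gamma>[OF I(2)], of ?fx]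
      has_real_derivative_along_curve[OF _ d\<gamma>[OF I(2)], of ?fy] C2 \<gamma>[OF I(2)] by (auto simp: fyx)
  have "((\<lambda>s. ?v s $ 1 * ?fx (\<gamma> s) + ?v s $ 2 * ?fy (\<gamma> s)) has_real_derivative
      (w $ 1 * ?a + (?v1 * ?fxx + ?v2 * ?fxy) * ?v1) + (w $ 2 * ?b + (?v1 * ?fxy + ?v2 * ?fyy) * ?v2)) (at t)"
    by (intro DERIV_add DERIV_mult dv' da db)
  moreover have "((\<lambda>s. ?v s $ 1 * ?fx (\<gamma> s) + ?v s $ 2 * ?fy (\<gamma> s)) has_real_derivative 0) (at t)"
    by (rule has_field_derivative_transform_within_open[OF DERIV_const[of 0] I]) (use tangent in auto)
  ultimately have 1: "(w $ 1 * ?a + (?v1 * ?fxx + ?v2 * ?fxy) * ?v1) + (w $ 2 * ?b + (?v1 * ?fxy + ?v2 * ?fyy) * ?v2) = 0"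
    by (rule DERIV_unique)
  have acc: "w $ i = 2 * \<kappa> / ?u * (2 * (?x * ?v1 + ?y * ?v2) * ?v t $ i - (?v1\<^sup>2 + ?v2\<^sup>2) * \<gamma> t $ i)" for i
  proof -
    have "cov_acceleration (const_curv_metric \<kappa>) \<gamma> t = 0"
      using geo I by (simp add: geodesic_on_def)
    then show ?thesis
      using cov_acceleration_const_curv_metric[of \<kappa> \<gamma> t i, OF u] by (simp add: w_def)
  qed
  define k where "k = 2 * \<kappa> / ?u"
  define S where "S = ?a\<^sup>2 + ?b\<^sup>2"
  \<comment> \<open>The coefficient of the velocity along (b, -a); the velocity is a multiple of
    that vector because it is orthogonal to the gradient.\<close>
  define \<mu> where "\<mu> = (?b * ?v1 - ?a * ?v2) / S"
  have S: "S \<noteq> 0" using reg by (simp add: S_def sum_power2_eq_zero_iff)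
  have "?v1 * S = ?b * (?b * ?v1 - ?a * ?v2) + ?a * (?v1 * ?a + ?v2 * ?b)"
    "?v2 * S = - ?a * (?b * ?v1 - ?a * ?v2) + ?b * (?v1 * ?a + ?v2 * ?b)"
    by (simp_all add: S_def algebra_simps power2_eq_square)
  with S tangent[OF I(2)] have v: "?v1 = \<mu> * ?b" "?v2 = - \<mu> * ?a"
    by (simp_all add: \<mu>_def field_simps)
  have "?v t \<noteq> 0" using geo I by (auto simp: geodesic_on_def)
  then have \<mu>: "\<mu> \<noteq> 0" using v by (auto simp: vec_eq_iff forall_2)
  \<comment> \<open>Both summands of the second derivative are quadratic in the velocity, so
    \<open>\<mu>\<close> splits off as a square and can be cancelled.\<close>
  have "\<mu>\<^sup>2 * (?b\<^sup>2 * ?fxx - 2 * ?a * ?b * ?fxy + ?a\<^sup>2 * ?fyy - k * ((?x * ?a + ?y * ?b) * S)) =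
     (w $ 1 * ?a + (?v1 * ?fxx + ?v2 * ?fxy) * ?v1) + (w $ 2 * ?b + (?v1 * ?fxy + ?v2 * ?fyy) * ?v2)"
    unfolding acc k_def[symmetric] unfolding v S_def by (simp add: algebra_simps power2_eq_square)
  with 1 \<mu> have "?b\<^sup>2 * ?fxx - 2 * ?a * ?b * ?fxy + ?a\<^sup>2 * ?fyy = k * ((?x * ?a + ?y * ?b) * S)"
    by simp
  then show ?thesis by (simp add: geodesic_pde_at_def k_def S_def)
qed

text \<open>This \<open>\<rho>\<close> gives the curve unit length velocity in the metric, as an
  affine parameter requires up to a constant. The acceleration is computed by differentiating the
  velocity field along the curve and is then compared with the connection term in each
  coordinate.\<close>

lemma integral_curve_geodesic:
  fixes f :: "real ^ 2 \<Rightarrow> real" and \<kappa> :: real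
  defines "\<rho> \<equiv> \<lambda>q. conf_denom \<kappa> q / sqrt ((pderiv_at 1 f q)\<^sup>2 + (pderiv_at 2 f q)\<^sup>2)"
  assumes D: "open D" and C2: "Ck_on 2 f D"
    and reg: "\<And>q. q \<in> D \<Longrightarrow> pderiv_at 1 f q \<noteq> 0 \<or> pderiv_at 2 f q \<noteq> 0"
    and u: "\<And>q. q \<in> D \<Longrightarrow> conf_denom \<kappa> q \<noteq> 0"
    and pde: "\<And>q. q \<in> D \<Longrightarrow> geodesic_pde_at \<kappa> f q"
    and I: "open I" and \<gamma>: "\<And>t. t \<in> I \<Longrightarrow> \<gamma> t \<in> D"
    and \<gamma>': "\<forall>t\<in>I. (\<gamma> has_vector_derivative
       \<rho> (\<gamma> t) *\<^sub>R (pderiv_at 2 f (\<gamma> t) *\<^sub>R axis 1 1 - pderiv_at 1 f (\<gamma> t) *\<^sub>R axis 2 1)) (at t)"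
  shows "geodesic_on (const_curv_metric \<kappa>) I \<gamma>"
  unfolding geodesic_on_def
proof
  fix t assume t: "t \<in> I"
  note C2 = C2[unfolded numeral_2_eq_2 Ck_on.simps]
  let ?fx = "pderiv_at 1 f" and ?fy = "pderiv_at 2 f"
  let ?W = "\<lambda>q. \<rho> q *\<^sub>R (?fy q *\<^sub>R axis 1 1 - ?fx q *\<^sub>R axis 2 1) :: real ^ 2"
  have vel: "velocity \<gamma> s = ?W (\<gamma> s)" if "s \<in> I" for s
    unfolding velocity_def by (rule vector_derivative_at[OF bspec[OF \<gamma>' that]])
  let ?a = "?fx (\<gamma> t)" and ?b = "?fy (\<gamma> t)" and ?r = "\<rho> (\<gamma> t)"
    and ?u = "conf_denom \<kappa> (\<gamma> t)" and ?x = "\<gamma> t $ 1" and ?y = "\<gamma> t $ 2"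
  let ?fxx = "pderiv_at 1 ?fx (\<gamma> t)" and ?fxy = "pderiv_at 2 ?fx (\<gamma> t)" and ?fyy = "pderiv_at 2 ?fy (\<gamma> t)"
  define S where "S = ?a\<^sup>2 + ?b\<^sup>2"
  \<comment> \<open>Derivatives along the curve, freed of powers of \<open>\<rho>\<close>:
    \<open>?fx\<close> has derivative \<open>?r * A\<close>, \<open>?fy\<close> has
    \<open>?r * B\<close>, and \<open>conf_denom \<kappa>\<close> has
    \<open>2 * \<kappa> * ?r * P\<close>. Logarithmic differentiation of \<open>\<rho>\<close> then
    gives \<open>?r\<^sup>2 * Q\<close>.\<close>
  define A where "A = ?b * ?fxx - ?a * ?fxy"
  define B where "B = ?b * ?fxy - ?a * ?fyy"
  define P where "P = ?x * ?b - ?y * ?a"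
  define Q where "Q = 2 * \<kappa> * P / ?u - (?a * A + ?b * B) / S"
  have S: "S > 0" using reg[OF \<gamma>[OF t]] unfolding S_def sum_power2_gt_zero_iff .
  have u0: "?u \<noteq> 0" by (rule u[OF \<gamma>[OF t]])
  have sqrt0: "sqrt S \<noteq> 0" using S by simp
  have r: "?r = ?u / sqrt S" by (simp add: \<rho>_def S_def)
  have r0: "?r \<noteq> 0" using u0 S by (simp add: r)
  have fyx: "pderiv_at 1 ?fy (\<gamma> t) = ?fxy"
    using pderiv_at_commute[OF D \<gamma>[OF t] assms(3)] .
  have "((\<lambda>s. ?fx (\<gamma> s)) has_real_derivative ?W (\<gamma> t) $ 1 * ?fxx + ?W (\<gamma> t) $ 2 * ?fxy) (at t)"
    by (rule has_real_derivative_along_curve[OF _ bspec[OF \<gamma>' t]]) (use C2 \<gamma>[OF t] in auto)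
  then have da: "((\<lambda>s. ?fx (\<gamma> s)) has_real_derivative ?r * A) (at t)"
    by (rule DERIV_cong) (simp add: A_def axis_def algebra_simps)
  have "((\<lambda>s. ?fy (\<gamma> s)) has_real_derivative ?W (\<gamma> t) $ 1 * ?fxy + ?W (\<gamma> t) $ 2 * ?fyy) (at t)"
    unfolding fyx[symmetric]
    by (rule has_real_derivative_along_curve[OF _ bspec[OF \<gamma>' t]]) (use C2 \<gamma>[OF t] in auto)
  then have db: "((\<lambda>s. ?fy (\<gamma> s)) has_real_derivative ?r * B) (at t)"
    by (rule DERIV_cong) (simp add: B_def axis_def algebra_simps)
  have "((\<lambda>s. conf_denom \<kappa> (\<gamma> s)) has_real_derivative
      ?W (\<gamma> t) $ 1 * pderiv_at 1 (conf_denom \<kappa>) (\<gamma> t) + ?W (\<gamma> t) $ 2 * pderiv_at 2 (conf_denom \<kappa>) (\<gamma> t)) (at t)"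
    by (rule has_real_derivative_along_curve[OF _ bspec[OF \<gamma>' t]])
      (use has_derivative_conf_denom differentiable_def in blast)
  then have du: "((\<lambda>s. conf_denom \<kappa> (\<gamma> s)) has_real_derivative 2 * \<kappa> * ?r * P) (at t)"
    by (rule DERIV_cong) (simp add: pderiv_at_eqI[OF has_derivative_conf_denom] P_def axis_def algebra_simps)
  have dr: "((\<lambda>s. \<rho> (\<gamma> s)) has_real_derivative ?r\<^sup>2 * Q) (at t)"
  proof -
    have dS: "((\<lambda>s. (?fx (\<gamma> s))\<^sup>2 + (?fy (\<gamma> s))\<^sup>2) has_real_derivative 2 * ?r * (?a * A + ?b * B)) (at t)"
      by (rule derivative_eq_intros da db refl)+ (simp add: algebra_simps)
    have dN: "((\<lambda>s. sqrt ((?fx (\<gamma> s))\<^sup>2 + (?fy (\<gamma> s))\<^sup>2)) has_real_derivative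
        inverse (sqrt S) / 2 * (2 * ?r * (?a * A + ?b * B))) (at t)"
      using DERIV_chain2[OF DERIV_real_sqrt dS] S by (simp add: S_def)
    have "((\<lambda>s. \<rho> (\<gamma> s)) has_real_derivative
       (2 * \<kappa> * ?r * P * sqrt S - ?u * (inverse (sqrt S) / 2 * (2 * ?r * (?a * A + ?b * B)))) / (sqrt S * sqrt S)) (at t)"
      unfolding \<rho>_def S_def
      by (rule DERIV_divide[OF du[unfolded \<rho>_def] dN[unfolded S_def \<rho>_def] sqrt0[unfolded S_def]])
    then show ?thesis
    proof (rule DERIV_cong)
      \<comment> \<open>Replacing the root by \<open>N\<close> with \<open>S = N\<^sup>2\<close>
        turns the claim into rational arithmetic.\<close>
      have "(2 * \<kappa> * ?r * P * N - ?u * (inverse N / 2 * (2 * ?r * (?a * A + ?b * B)))) / (N * N) = ?r\<^sup>2 * Q"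
        if "N = sqrt S" for N
      proof -
        have "N \<noteq> 0" "S = N\<^sup>2" "?r = ?u / N" using that S r by auto
        moreover have "(2 * \<kappa> * r * P * N - c * (inverse N / 2 * (2 * r * z))) / (N * N) = r\<^sup>2 * (2 * \<kappa> * P / c - z / N\<^sup>2)"
          if "c \<noteq> 0" "N \<noteq> 0" "r = c / N" for c z r
          unfolding that(3) using that(1,2) by (simp add: divide_simps power2_eq_square) (simp add: algebra_simps)
        ultimately show ?thesis using u0 unfolding Q_def by (metis (no_types))
      qed
      then show "(2 * \<kappa> * ?r * P * sqrt S - ?u * (inverse (sqrt S) / 2 * (2 * ?r * (?a * A + ?b * B)))) / (sqrt S * sqrt S) = ?r\<^sup>2 * Q"
        by blast
    qed
  qed
  \<comment> \<open>The product rule applied to \<open>\<rho> * ?fy\<close> and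
    \<open>\<rho> * ?fx\<close>.\<close>
  let ?w = "(?r\<^sup>2 * (Q * ?b + B)) *\<^sub>R axis 1 1 - (?r\<^sup>2 * (Q * ?a + A)) *\<^sub>R axis 2 1 :: real ^ 2"
  have "((\<lambda>s. ?W (\<gamma> s)) has_vector_derivative ?w) (at t)"
  proof -
    have "((\<lambda>s. (\<rho> (\<gamma> s) * ?fy (\<gamma> s)) *\<^sub>R axis 1 1 - (\<rho> (\<gamma> s) * ?fx (\<gamma> s)) *\<^sub>R axis 2 1 :: real ^ 2)
       has_vector_derivative ?w) (at t)"
      by (intro has_vector_derivative_diff has_vector_derivative_scaleR[OF _ has_vector_derivative_const, THEN has_vector_derivative_eq_rhs]
            DERIV_mult[OF dr da, THEN DERIV_cong] DERIV_mult[OF dr db, THEN DERIV_cong])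
        (auto simp: algebra_simps power2_eq_square)
    then show ?thesis by (simp add: scaleR_diff_right)
  qed
  then have dv: "(velocity \<gamma> has_vector_derivative ?w) (at t)"
    by (rule has_vector_derivative_transform_within_open[OF _ I t]) (simp add: vel)
  have w: "vector_derivative (velocity \<gamma>) (at t) = ?w" by (rule vector_derivative_at[OF dv])
  \<comment> \<open>The left side of the equation is exactly \<open>?b * A - ?a * B\<close>.\<close>
  have pde_t: "?u * (?a * B - ?b * A) = - (2 * \<kappa> * (?x * ?a + ?y * ?b) * S)"
    using pde[OF \<gamma>[OF t]] u0
    by (simp add: geodesic_pde_at_def Let_def A_def B_def S_def field_simps power2_eq_square)
  \<comment> \<open>The first coordinate of the geodesic equation, divided by
    \<open>?r\<^sup>2\<close> and cleared of denominators. It is arranged so that the derivatives of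
    \<open>f\<close> of second order enter through \<open>?a * B - ?b * A\<close>, apart from a
    multiple of \<open>S - ?a\<^sup>2 - ?b\<^sup>2\<close>, which is zero.\<close>
  have "S * ?u * (Q * ?b + B - 2 * \<kappa> / ?u * (2 * P * ?b - S * ?x)) = 0"
  proof -
    have "S * ?u * (Q * ?b + B - 2 * \<kappa> / ?u * (2 * P * ?b - S * ?x)) =
       ?a * (?u * (?a * B - ?b * A)) + ?u * B * (S - ?a\<^sup>2 - ?b\<^sup>2) - 2 * \<kappa> * S * (P * ?b - S * ?x)"
      using S u0 by (simp add: Q_def field_simps power2_eq_square)
    then show ?thesis
      unfolding pde_t by (simp add: S_def P_def algebra_simps power2_eq_square)
  qed
  moreover have "S * ?u * (Q * ?a + A - 2 * \<kappa> / ?u * (2 * P * ?a + S * ?y)) = 0"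
  proof -
    have "S * ?u * (Q * ?a + A - 2 * \<kappa> / ?u * (2 * P * ?a + S * ?y)) =
       - ?b * (?u * (?a * B - ?b * A)) + ?u * A * (S - ?a\<^sup>2 - ?b\<^sup>2) - 2 * \<kappa> * S * (P * ?a + S * ?y)"
      using S u0 by (simp add: Q_def field_simps power2_eq_square)
    then show ?thesis
      unfolding pde_t by (simp add: S_def P_def algebra_simps power2_eq_square)
  qed
  ultimately have Q: "Q * ?b + B = 2 * \<kappa> / ?u * (2 * P * ?b - S * ?x)"
    "Q * ?a + A = 2 * \<kappa> / ?u * (2 * P * ?a + S * ?y)"
    using S u0 by auto
  have v: "velocity \<gamma> t $ 1 = ?r * ?b" "velocity \<gamma> t $ 2 = - (?r * ?a)"
    by (simp_all add: vel[OF t] axis_def)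
  have "cov_acceleration (const_curv_metric \<kappa>) \<gamma> t = 0"
    unfolding vec_eq_iff forall_2 cov_acceleration_const_curv_metric[of \<kappa> \<gamma> t, OF u0] w v
    by (simp add: axis_def Q) (simp add: P_def S_def divide_inverse algebra_simps power2_eq_square)
  moreover have "velocity \<gamma> t \<noteq> 0"
    using v r0 reg[OF \<gamma>[OF t]] by (auto simp: vec_eq_iff forall_2)
  moreover have "\<gamma> differentiable at t" "velocity \<gamma> differentiable at t"
    using bspec[OF \<gamma>' t] dv by (auto simp: has_vector_derivative_def differentiable_def)
  ultimately show "\<gamma> differentiable at t \<and> velocity \<gamma> differentiable at t \<and>
      velocity \<gamma> t \<noteq> 0 \<and> cov_acceleration (const_curv_metric \<kappa>) \<gamma> t = 0"
    by blast
qed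

section \<open>The equivalence for the whole foliation\<close>

theorem theorem19:
  fixes \<kappa> :: real and D :: "(real ^ 2) set" and f :: "real ^ 2 \<Rightarrow> real"
  assumes "open D" and "connected D"
    and "\<And>p. p \<in> D \<Longrightarrow> 1 + \<kappa> * ((p $ 1)\<^sup>2 + (p $ 2)\<^sup>2) \<noteq> 0"
    and "smooth_on f D"
    and "\<And>p. p \<in> D \<Longrightarrow> frechet_derivative f (at p) \<noteq> (\<lambda>h. 0)"
  shows "level_sets_geodesic (const_curv_metric \<kappa>) D f \<longleftrightarrow>
    (\<forall>p\<in>D. let x = p $ 1; y = p $ 2;
               fx = pderiv_at 1 f p; fy = pderiv_at 2 f p;
               fxx = pderiv_at 1 (pderiv_at 1 f) p;
               fxy = pderiv_at 2 (pderiv_at 1 f) p;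
               fyy = pderiv_at 2 (pderiv_at 2 f) p
           in fy\<^sup>2 * fxx - 2 * fx * fy * fxy + fx\<^sup>2 * fyy
              = 2 * \<kappa> * (x * fx + y * fy) * (fx\<^sup>2 + fy\<^sup>2) / (1 + \<kappa> * (x\<^sup>2 + y\<^sup>2)))"
proof -
  have C2: "Ck_on 2 f D" using assms(4) by (simp add: smooth_on_def)
  then have diff: "f differentiable (at q)" and diff': "pderiv_at i f differentiable (at q)" if "q \<in> D" for i q
    using that by (auto simp: numeral_2_eq_2)
  have u: "conf_denom \<kappa> q \<noteq> 0" if "q \<in> D" for q
    using assms(3)[OF that] by (simp add: conf_denom_def)
  have reg: "pderiv_at 1 f q \<noteq> 0 \<or> pderiv_at 2 f q \<noteq> 0" if "q \<in> D" for q
  proof (rule ccontr)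
    assume "\<not> ?thesis"
    then have "(f has_derivative (\<lambda>h. 0)) (at q)"
      using has_derivative_pderiv_at[OF diff[OF that]] by simp
    then show False using assms(5)[OF that] frechet_derivative_at by metis
  qed
  have "level_sets_geodesic (const_curv_metric \<kappa>) D f \<longleftrightarrow> (\<forall>p\<in>D. geodesic_pde_at \<kappa> f p)"
  proof (intro iffI ballI)
    fix p assume L: "level_sets_geodesic (const_curv_metric \<kappa>) D f" and p: "p \<in> D"
    then have "unparametrized_geodesic (const_curv_metric \<kappa>) {q \<in> D. f q = f p}"
      by (simp add: level_sets_geodesic_def)
    then have "\<exists>U I \<gamma>. open U \<and> p \<in> U \<and> open I \<and> is_interval I
        \<and> geodesic_on (const_curv_metric \<kappa>) I \<gamma> \<and> \<gamma> ` I = {q \<in> D. f q = f p} \<inter> U"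
      unfolding unparametrized_geodesic_def by (rule bspec) (use p in simp)
    then obtain U I \<gamma> where U: "p \<in> U" "open I" "geodesic_on (const_curv_metric \<kappa>) I \<gamma>"
      "\<gamma> ` I = {q \<in> D. f q = f p} \<inter> U"
      by (elim exE conjE)
    \<comment> \<open>The trace fills the level set inside \<open>U\<close>, so the geodesic passes
      through \<open>p\<close> at some time.\<close>
    have "p \<in> \<gamma> ` I" unfolding U(4) using p U(1) by simp
    then obtain t where t: "t \<in> I" "\<gamma> t = p" by auto
    have "geodesic_pde_at \<kappa> f (\<gamma> t)"
    proof (rule geodesic_pde_at_level_geodesic[OF assms(1) C2 _ _ U(3) U(2) t(1)])
      show "\<gamma> s \<in> D \<and> f (\<gamma> s) = f p" if "s \<in> I" for s using U(4) that by blast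
    qed (use t p reg u in auto)
    then show "geodesic_pde_at \<kappa> f p" using t by simp
  next
    assume pde: "\<forall>p\<in>D. geodesic_pde_at \<kappa> f p"
    let ?\<rho> = "\<lambda>q. conf_denom \<kappa> q / sqrt ((pderiv_at 1 f q)\<^sup>2 + (pderiv_at 2 f q)\<^sup>2)"
    have cont: "continuous_on D (pderiv_at i f)" for i
      using diff' by (intro continuous_at_imp_continuous_on) (auto intro: differentiable_imp_continuous_within)
    have "continuous_on D (conf_denom \<kappa>)"
      using has_derivative_conf_denom has_derivative_continuous by (blast intro: continuous_at_imp_continuous_on)
    then have \<rho>: "continuous_on D ?\<rho>"
      using reg by (intro continuous_intros cont) (auto simp: sum_power2_eq_zero_iff)
    have \<rho>0: "?\<rho> q \<noteq> 0" if "q \<in> D" for q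
      using u[OF that] reg[OF that] by (simp add: sum_power2_eq_zero_iff)
    \<comment> \<open>One local geodesic for each point of \<open>D\<close> is enough, since a point
      \<open>p\<close> of a level set fixes its value as \<open>f p\<close>; as \<open>U\<close>
      lies in \<open>D\<close>, the level set within \<open>U\<close> is the same whether taken in
      \<open>U\<close> or in \<open>D\<close>.\<close>
    have "\<exists>U I \<gamma>. open U \<and> p \<in> U \<and> open I \<and> is_interval I
        \<and> geodesic_on (const_curv_metric \<kappa>) I \<gamma> \<and> \<gamma> ` I = {q \<in> D. f q = f p} \<inter> U" if p: "p \<in> D" for p
    proof -
      obtain U I \<gamma> where U: "open U" "p \<in> U" "U \<subseteq> D" and I: "open I" "is_interval I"
        and im: "\<gamma> ` I = {q \<in> U. f q = f p}"
        and \<gamma>': "\<forall>t\<in>I. (\<gamma> has_vector_derivative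
           ?\<rho> (\<gamma> t) *\<^sub>R (pderiv_at 2 f (\<gamma> t) *\<^sub>R axis 1 1 - pderiv_at 1 f (\<gamma> t) *\<^sub>R axis 2 1)) (at t)"
        by (rule level_set_integral_curve[OF assms(1) p diff cont reg[OF p] \<rho> \<rho>0]) (assumption | rule that)+
      have "geodesic_on (const_curv_metric \<kappa>) I \<gamma>"
        by (rule integral_curve_geodesic[OF assms(1) C2 reg u _ I(1) _ \<gamma>']) (use pde im U in auto)
      moreover have "\<gamma> ` I = {q \<in> D. f q = f p} \<inter> U" using im U by auto
      ultimately show ?thesis using U I by blast
    qed
    then show "level_sets_geodesic (const_curv_metric \<kappa>) D f"
      unfolding level_sets_geodesic_def unparametrized_geodesic_def by auto
  qed
  then show ?thesis
    by (simp add: geodesic_pde_at_def conf_denom_def Let_def)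
qed

end
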